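(* Let $\mathcal{F}$ be a minor-closed family of multigraphs. Then the limiting density of $\mathcal{F}$ is either an integer, or a superparticular ratio $i/(i+1)$ for a positive integer $i$, or unbounded (infinite).
   Context: Multigraphs are finite graphs that may have multiple edges between the same pair of vertices and any number of self-loops at a vertex. Minors of multigraphs are formed by contracting edges (without removing the resulting parallel edges or loops), deleting edges and deleting vertices. A family is minor-closed if it contains every minor of each of its members. The limiting density of $\mathcal{F}$ is $\limsup_{n\to\infty}\mathrm{ex}_{\mathcal{F}}(n)/n$, where $\mathrm{ex}_{\mathcal{F}}(n)$ is the supremum of the number of edges (counted with multiplicity, loops included) of an $n$-vertex multigraph in $\mathcal{F}$ ($0$ if none); it is unbounded if this quantity is infinite. *)

theory Defs
  imports Complex_Main "HOL-Library.Extended_Real"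
begin

text \<open>
  An edge with one end is a self-loop. The function \<open>ends\<close> is irrelevant outside \<open>edges\<close>.
\<close>

record ('v, 'e) mgraph =
  verts :: "'v set"
  edges :: "'e set"
  ends :: "'e \<Rightarrow> 'v set"

definition multigraph :: "('v, 'e) mgraph \<Rightarrow> bool" where
  "multigraph G \<longleftrightarrow> finite (verts G) \<and> finite (edges G) \<and>
     (\<forall>e \<in> edges G. ends G e \<subseteq> verts G \<and> card (ends G e) \<in> {1, 2})"

definition isomorphic :: "('v, 'e) mgraph \<Rightarrow> ('v, 'e) mgraph \<Rightarrow> bool" where
  "isomorphic G H \<longleftrightarrow> (\<exists>f g. bij_betw f (verts G) (verts H) \<and> bij_betw g (edges G) (edges H) \<and>
     (\<forall>e \<in> edges G. ends H (g e) = f ` ends G e))"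

definition delete_edge :: "('v, 'e) mgraph \<Rightarrow> 'e \<Rightarrow> ('v, 'e) mgraph" where
  "delete_edge G e = G\<lparr>edges := edges G - {e}\<rparr>"

definition delete_vertex :: "('v, 'e) mgraph \<Rightarrow> 'v \<Rightarrow> ('v, 'e) mgraph" where
  "delete_vertex G v = G\<lparr>verts := verts G - {v}, edges := {e \<in> edges G. v \<notin> ends G e}\<rparr>"

text \<open>
  The edge \<open>e\<close> disappears and its ends are merged into the vertex \<open>u\<close>, meant to be one of them.
  All other edges are kept: edges parallel to \<open>e\<close> become loops at \<open>u\<close>. Contracting a loop
  amounts to deleting it.
\<close>

definition contract_edge :: "('v, 'e) mgraph \<Rightarrow> 'e \<Rightarrow> 'v \<Rightarrow> ('v, 'e) mgraph" where
  "contract_edge G e u =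
     (let f = (\<lambda>x. if x \<in> ends G e then u else x)
      in \<lparr>verts = f ` verts G, edges = edges G - {e}, ends = (\<lambda>d. f ` ends G d)\<rparr>)"

text \<open>\<open>minor_of G H\<close>: the multigraph \<open>H\<close> is, up to isomorphism, a minor of \<open>G\<close>.\<close>

inductive minor_of :: "('v, 'e) mgraph \<Rightarrow> ('v, 'e) mgraph \<Rightarrow> bool" for G where
  refl: "minor_of G G"
| iso: "minor_of G H \<Longrightarrow> isomorphic H K \<Longrightarrow> minor_of G K"
| delete_edge: "minor_of G H \<Longrightarrow> e \<in> edges H \<Longrightarrow> minor_of G (delete_edge H e)"
| delete_vertex: "minor_of G H \<Longrightarrow> v \<in> verts H \<Longrightarrow> minor_of G (delete_vertex H v)"
| contract_edge: "minor_of G H \<Longrightarrow> e \<in> edges H \<Longrightarrow> u \<in> ends H e \<Longrightarrow>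
    minor_of G (contract_edge H e u)"

definition minor_closed :: "('v, 'e) mgraph set \<Rightarrow> bool" where
  "minor_closed F \<longleftrightarrow> (\<forall>G \<in> F. \<forall>H. minor_of G H \<longrightarrow> H \<in> F)"

text \<open>The supremum of the empty set in \<^typ>\<open>enat\<close> is \<open>0\<close>.\<close>

definition ex :: "('v, 'e) mgraph set \<Rightarrow> nat \<Rightarrow> enat" where
  "ex F n = (SUP G \<in> {G \<in> F. card (verts G) = n}. enat (card (edges G)))"

definition limiting_density :: "('v, 'e) mgraph set \<Rightarrow> ereal" where
  "limiting_density F = limsup (\<lambda>n. ereal_of_enat (ex F n) / ereal (real n))"

lemma multigraph_isomorphic:
  assumes "multigraph G" "isomorphic G H"
  shows "multigraph H"
proof -
  obtain f g where f: "bij_betw f (verts G) (verts H)" and g: "bij_betw g (edges G) (edges H)"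
    and fg: "\<forall>e \<in> edges G. ends H (g e) = f ` ends G e"
    using assms(2) unfolding isomorphic_def by blast
  have "ends H d \<subseteq> verts H \<and> card (ends H d) \<in> {1, 2}" if "d \<in> edges H" for d
  proof -
    obtain e where e: "e \<in> edges G" "d = g e"
      using \<open>d \<in> edges H\<close> g by (auto simp: bij_betw_def)
    have sub: "ends G e \<subseteq> verts G" and "card (ends G e) \<in> {1, 2}"
      using assms(1) e by (auto simp: multigraph_def)
    moreover have "card (f ` ends G e) = card (ends G e)"
      using f sub by (meson bij_betw_def card_image inj_on_subset)
    moreover have "f ` ends G e \<subseteq> verts H"
      using f sub by (auto simp: bij_betw_def)
    ultimately show ?thesis using fg e by auto
  qed
  then show ?thesis
    using assms(1) f g by (auto simp: multigraph_def bij_betw_finite)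
qed

lemma multigraph_delete_edge: "multigraph G \<Longrightarrow> multigraph (delete_edge G e)"
  by (simp add: multigraph_def delete_edge_def)

lemma multigraph_delete_vertex: "multigraph G \<Longrightarrow> multigraph (delete_vertex G v)"
  by (auto simp: multigraph_def delete_vertex_def)

lemma multigraph_contract_edge:
  assumes "multigraph G"
  shows "multigraph (contract_edge G e u)"
proof -
  define f where "f = (\<lambda>x. if x \<in> ends G e then u else x)"
  have "card (f ` ends G d) \<in> {1, 2}" if "d \<in> edges G" for d
  proof -
    have c: "card (ends G d) \<in> {1, 2}" and fin: "finite (ends G d)"
      using assms that by (auto simp: multigraph_def intro: finite_subset)
    have "card (f ` ends G d) \<le> card (ends G d)" by (rule card_image_le[OF fin])
    moreover have "card (f ` ends G d) \<noteq> 0" using c fin by auto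
    ultimately show ?thesis using c by auto
  qed
  then show ?thesis
    using assms by (auto simp: multigraph_def contract_edge_def Let_def simp flip: f_def)
qed

lemma multigraph_minor_of: "minor_of G H \<Longrightarrow> multigraph G \<Longrightarrow> multigraph H"
  by (induction rule: minor_of.induct)
    (auto intro: multigraph_isomorphic multigraph_delete_edge multigraph_delete_vertex
      multigraph_contract_edge)

end

theory Submission
  imports Defs
begin

text \<open>
  Let \<open>|E| + c - |V|\<close> be the cyclomatic number of a multigraph with \<open>c\<close> components. It is additive
  over components, and contracting non-loop edges shrinks a multigraph to any number of vertices
  between \<open>c\<close> and \<open>|V|\<close> without changing either. Suppose the density of \<open>F\<close> is finite and let
  \<open>k\<close> be maximal such that members of \<open>F\<close> have arbitrarily many components of cyclomatic number at
  least \<open>k\<close>. Some \<open>ex F N\<close> with \<open>N \<ge> 1\<close> is finite; shrinking large members, or unions of \<open>N\<close> of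
  their components, to \<open>N\<close> vertices shows that a large member has cyclomatic number at most
  \<open>k c + O(1)\<close>, that is, at most \<open>|V| + (k - 1) c + O(1)\<close> edges.

  If \<open>k \<ge> 1\<close>, the density is \<open>k\<close>, attained by disjoint bouquets of \<open>k\<close> loops. If \<open>k = 0\<close>, the number
  of edges is at most \<open>|V| - c + O(1)\<close>: the density is \<open>1\<close> if components are arbitrarily large, and
  otherwise it is \<open>s / (s + 1)\<close>, where \<open>s + 1\<close> is the largest size that arbitrarily many components
  can reach simultaneously.
\<close>

section \<open>Components\<close>

definition adjacency :: "('v, 'e) mgraph \<Rightarrow> 'v rel" where
  "adjacency G = {(x, y). \<exists>e \<in> edges G. x \<in> ends G e \<and> y \<in> ends G e}"

definition component :: "('v, 'e) mgraph \<Rightarrow> 'v \<Rightarrow> 'v set" where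
  "component G x = (adjacency G)\<^sup>* `` {x}"

definition components :: "('v, 'e) mgraph \<Rightarrow> 'v set set" where
  "components G = component G ` verts G"

lemma component_refl: "x \<in> component G x"
  by (simp add: component_def)

lemma component_eq:
  assumes "y \<in> component G x"
  shows "component G y = component G x"
proof -
  have "sym ((adjacency G)\<^sup>*)"
    by (intro sym_rtrancl symI) (auto simp: adjacency_def)
  then show ?thesis
    using assms unfolding component_def by (auto dest: symD intro: rtrancl_trans)
qed

lemma ends_subset_component: "e \<in> edges G \<Longrightarrow> x \<in> ends G e \<Longrightarrow> ends G e \<subseteq> component G x"
  by (auto simp: component_def adjacency_def)

lemma component_eq_if_ends:
  assumes "e \<in> edges G" "x \<in> ends G e" "y \<in> ends G e"
  shows "component G x = component G y"
  using ends_subset_component[OF assms(1,3)] assms(2) by (intro component_eq) blast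

lemma component_in_components: "C \<in> components G \<Longrightarrow> x \<in> C \<Longrightarrow> component G x = C"
  by (auto simp: components_def component_eq)

lemma components_nonempty: "C \<in> components G \<Longrightarrow> C \<noteq> {}"
  using component_refl by (force simp: components_def)

lemma pairwise_disjnt_components: "pairwise disjnt (components G)"
proof (rule pairwiseI)
  fix C D assume "C \<in> components G" "D \<in> components G" "C \<noteq> D"
  then show "disjnt C D"
    using component_in_components[of C G] component_in_components[of D G] by (auto simp: disjnt_iff)
qed

lemma multigraph_finite_verts: "multigraph G \<Longrightarrow> finite (verts G)"
  and multigraph_finite_edges: "multigraph G \<Longrightarrow> finite (edges G)"
  and multigraph_ends_subset: "multigraph G \<Longrightarrow> e \<in> edges G \<Longrightarrow> ends G e \<subseteq> verts G"
  and multigraph_ends_nonempty: "multigraph G \<Longrightarrow> e \<in> edges G \<Longrightarrow> ends G e \<noteq> {}"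
  by (auto simp: multigraph_def)

lemma Union_components:
  assumes "multigraph G"
  shows "\<Union>(components G) = verts G"
proof -
  have "component G x \<subseteq> verts G" if "x \<in> verts G" for x
  proof -
    have "adjacency G `` verts G \<subseteq> verts G"
      using multigraph_ends_subset[OF assms] by (auto simp: adjacency_def)
    then have "(adjacency G)\<^sup>* `` verts G = verts G"
      by (rule Image_closed_trancl)
    then show ?thesis
      using that by (auto simp: component_def)
  qed
  then show ?thesis
    using component_refl by (fastforce simp: components_def)
qed

lemma finite_components: "multigraph G \<Longrightarrow> finite (components G)"
  by (simp add: components_def multigraph_finite_verts)

lemma finite_component:
  assumes "multigraph G" "C \<in> components G"
  shows "finite C"
  using assms Union_components multigraph_finite_verts by (metis Sup_upper finite_subset)

lemma card_components_le: "multigraph G \<Longrightarrow> card (components G) \<le> card (verts G)"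
  by (simp add: components_def card_image_le multigraph_finite_verts)

lemma card_Union_subset_components:
  assumes "multigraph G" "J \<subseteq> components G"
  shows "card (\<Union>J) = (\<Sum>C\<in>J. card C)"
  using pairwise_subset[OF pairwise_disjnt_components assms(2)] assms(2)
    finite_component[OF assms(1)]
  by (intro card_Union_disjoint) auto

corollary card_verts_eq_sum_components:
  "multigraph G \<Longrightarrow> card (verts G) = (\<Sum>C\<in>components G. card C)"
  using card_Union_subset_components[of G "components G"] by (simp add: Union_components)

section \<open>Contractions\<close>

definition merge :: "'v set \<Rightarrow> 'v \<Rightarrow> 'v \<Rightarrow> 'v" where
  "merge A u x = (if x \<in> A then u else x)"

lemma contract_edge_simps:
  "verts (contract_edge G e u) = merge (ends G e) u ` verts G"
  "edges (contract_edge G e u) = edges G - {e}"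
  "ends (contract_edge G e u) d = merge (ends G e) u ` ends G d"
  by (simp_all add: contract_edge_def merge_def Let_def)

lemma component_merge:
  assumes "e \<in> edges G" "u \<in> ends G e"
  shows "component G (merge (ends G e) u x) = component G x"
  using assms component_eq_if_ends[of e G u x] by (simp add: merge_def)

lemma merge_in_component_contract_edge:
  assumes "y \<in> component G x"
  shows "merge (ends G e) u y \<in> component (contract_edge G e u) (merge (ends G e) u x)"
proof -
  define f where "f = merge (ends G e) u"
  define H where "H = contract_edge G e u"
  note H_simps = contract_edge_simps[of G e u, folded f_def H_def]
  from assms have "(x, y) \<in> (adjacency G)\<^sup>*"
    by (simp add: component_def)
  then have "(f x, f y) \<in> (adjacency H)\<^sup>*"
  proof (induction rule: rtrancl_induct)
    case (step y z)
    then obtain d where d: "d \<in> edges G" "y \<in> ends G d" "z \<in> ends G d"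
      by (auto simp: adjacency_def)
    have "(f y, f z) \<in> (adjacency H)\<^sup>*"
    proof (cases "d = e")
      case True
      then show ?thesis
        using d by (simp add: f_def merge_def)
    next
      case False
      then have "(f y, f z) \<in> adjacency H"
        using d by (auto simp: adjacency_def H_simps)
      then show ?thesis ..
    qed
    with step.IH show ?case
      by (rule rtrancl_trans)
  qed simp
  then show ?thesis
    by (simp add: component_def f_def H_def)
qed

lemma component_contract_edgeD:
  assumes e: "e \<in> edges G" "u \<in> ends G e"
    and y: "y \<in> component (contract_edge G e u) (merge (ends G e) u x)"
  shows "y \<in> component G x \<and> merge (ends G e) u y = y"
proof -
  define f where "f = merge (ends G e) u"
  define H where "H = contract_edge G e u"
  note H_simps = contract_edge_simps[of G e u, folded f_def H_def]
  have f_component: "component G (f z) = component G z" for z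
    unfolding f_def by (rule component_merge[OF e])
  have f_idem: "f (f z) = f z" for z
    using e(2) by (simp add: f_def merge_def)
  from y have "(f x, y) \<in> (adjacency H)\<^sup>*"
    by (simp add: component_def f_def H_def)
  then have "y \<in> component G x \<and> f y = y"
  proof (induction rule: rtrancl_induct)
    case base
    then show ?case
      using f_component f_idem component_refl by metis
  next
    case (step y z)
    then obtain d y' z' where "d \<in> edges G" "y' \<in> ends G d" "z' \<in> ends G d" "y = f y'" "z = f z'"
      by (auto simp: adjacency_def H_simps)
    then have "component G z = component G y" "f z = z"
      using f_component f_idem component_eq_if_ends by metis+
    then show ?case
      using step.IH component_eq component_refl by metis
  qed
  then show ?thesis
    by (simp add: f_def)
qed

lemma component_contract_edge:
  assumes "e \<in> edges G" "u \<in> ends G e"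
  shows "component (contract_edge G e u) (merge (ends G e) u x) =
    merge (ends G e) u ` component G x"
proof
  show "component (contract_edge G e u) (merge (ends G e) u x) \<subseteq>
      merge (ends G e) u ` component G x"
    using component_contract_edgeD[OF assms] by (metis imageI subsetI)
qed (auto intro: merge_in_component_contract_edge)

lemma card_components_contract_edge:
  assumes e: "e \<in> edges G" "u \<in> ends G e"
  shows "card (components (contract_edge G e u)) = card (components G)"
proof -
  let ?f = "merge (ends G e) u"
  have "components (contract_edge G e u) = (`) ?f ` components G"
    by (simp add: components_def contract_edge_simps image_image component_contract_edge[OF e])
  moreover have "inj_on ((`) ?f) (components G)"
  proof (rule inj_onI)
    fix C D assume CD: "C \<in> components G" "D \<in> components G" "?f ` C = ?f ` D"
    then obtain x y where "x \<in> C" "y \<in> D" "?f x = ?f y"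
      using components_nonempty[OF CD(1)] by blast
    then show "C = D"
      using CD component_in_components component_merge[OF e] by metis
  qed
  ultimately show ?thesis
    by (simp add: card_image)
qed

lemma card_verts_contract_edge:
  assumes "multigraph G" "e \<in> edges G" "u \<in> ends G e"
  shows "card (verts (contract_edge G e u)) + card (ends G e) = Suc (card (verts G))"
proof -
  have sub: "ends G e \<subseteq> verts G" and fin: "finite (verts G)"
    using assms by (auto simp: multigraph_def)
  have "verts (contract_edge G e u) = insert u (verts G - ends G e)"
    using assms(3) sub by (auto simp: contract_edge_simps merge_def)
  moreover have "card (verts G - ends G e) = card (verts G) - card (ends G e)"
    using sub fin by (simp add: card_Diff_subset finite_subset)
  moreover have "card (ends G e) \<le> card (verts G)"
    using sub fin by (simp add: card_mono)
  ultimately show ?thesis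
    using assms(3) fin by simp
qed

lemma card_edges_contract_edge:
  assumes "multigraph G" "e \<in> edges G"
  shows "card (edges G) = Suc (card (edges (contract_edge G e u)))"
  using multigraph_finite_edges[OF assms(1)] assms(2) unfolding contract_edge_simps
  by (rule card.remove)

lemma obtain_non_loop_edge:
  assumes "multigraph G" "card (components G) < card (verts G)"
  obtains e where "e \<in> edges G" "card (ends G e) = 2"
proof -
  have "\<exists>e\<in>edges G. card (ends G e) = 2"
  proof (rule ccontr)
    assume "\<not> ?thesis"
    then have "\<forall>e\<in>edges G. \<exists>x. ends G e = {x}"
      using assms(1) by (auto simp: multigraph_def card_1_singleton_iff)
    then have "adjacency G \<subseteq> Id"
      by (force simp: adjacency_def)
    then have "component G x = {x}" for x
      unfolding component_def using rtrancl_subset_rtrancl[of "adjacency G" "{}"] by auto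
    then show False
      using assms(2) by (simp add: components_def card_image)
  qed
  then show ?thesis
    using that by blast
qed

section \<open>The cyclomatic number\<close>

definition cyclomatic_number :: "('v, 'e) mgraph \<Rightarrow> nat" where
  "cyclomatic_number G = card (edges G) + card (components G) - card (verts G)"

lemma card_verts_le_edges_plus_components:
  assumes "multigraph G"
  shows "card (verts G) \<le> card (edges G) + card (components G)"
  using assms
proof (induction "card (edges G)" arbitrary: G rule: less_induct)
  case less
  show ?case
  proof (cases "card (components G) < card (verts G)")
    case True
    then obtain e where e: "e \<in> edges G" "card (ends G e) = 2"
      using obtain_non_loop_edge[OF less.prems] by blast
    then obtain u where u: "u \<in> ends G e"
      by fastforce
    let ?H = "contract_edge G e u"
    note edges = card_edges_contract_edge[OF less.prems e(1), of u]
    then have "card (verts ?H) \<le> card (edges ?H) + card (components ?H)"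
      by (intro less.hyps multigraph_contract_edge less.prems) simp
    then show ?thesis
      using edges e(2) card_verts_contract_edge[OF less.prems e(1) u]
      by (simp add: card_components_contract_edge[OF e(1) u])
  qed simp
qed

lemma cyclomatic_number_eq:
  assumes "multigraph G"
  shows "card (edges G) + card (components G) = card (verts G) + cyclomatic_number G"
  using card_verts_le_edges_plus_components[OF assms] by (simp add: cyclomatic_number_def)

lemma cyclomatic_number_contract_edge:
  assumes G: "multigraph G" and e: "e \<in> edges G" "card (ends G e) = 2" "u \<in> ends G e"
  shows "cyclomatic_number (contract_edge G e u) = cyclomatic_number G"
  using card_edges_contract_edge[OF G e(1), of u] card_verts_contract_edge[OF G e(1,3)] e(2)
  by (simp add: cyclomatic_number_def card_components_contract_edge[OF e(1,3)])

lemma exists_contraction_with_card_verts: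
  assumes "multigraph G" "card (components G) \<le> n" "n \<le> card (verts G)"
  shows "\<exists>H. minor_of G H \<and> card (verts H) = n \<and> card (components H) = card (components G) \<and>
    cyclomatic_number H = cyclomatic_number G"
  using assms(3,2)
proof (induction rule: inc_induct)
  case base
  then show ?case
    using minor_of.refl by blast
next
  case (step n)
  then obtain H where H: "minor_of G H" "card (verts H) = Suc n"
    "card (components H) = card (components G)" "cyclomatic_number H = cyclomatic_number G"
    by auto
  have multigraph: "multigraph H"
    using H(1) assms(1) by (rule multigraph_minor_of)
  have "card (components H) < card (verts H)"
    using step.prems H by simp
  then obtain e where e: "e \<in> edges H" "card (ends H e) = 2"
    using obtain_non_loop_edge[OF multigraph] by blast
  then obtain u where u: "u \<in> ends H e"
    by fastforce
  have "card (verts (contract_edge H e u)) = n"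
    using card_verts_contract_edge[OF multigraph e(1) u] e(2) H(2) by simp
  then show ?case
    using H e u minor_of.contract_edge[OF H(1) e(1) u]
      card_components_contract_edge[OF e(1) u] cyclomatic_number_contract_edge[OF multigraph e u]
    by metis
qed

section \<open>Induced subgraphs\<close>

definition induced_subgraph :: "('v, 'e) mgraph \<Rightarrow> 'v set \<Rightarrow> ('v, 'e) mgraph" where
  "induced_subgraph G S = G\<lparr>verts := S, edges := {e \<in> edges G. ends G e \<subseteq> S}\<rparr>"

lemma induced_subgraph_simps [simp]:
  "verts (induced_subgraph G S) = S"
  "edges (induced_subgraph G S) = {e \<in> edges G. ends G e \<subseteq> S}"
  "ends (induced_subgraph G S) = ends G"
  by (simp_all add: induced_subgraph_def)

lemma induced_subgraph_induced_subgraph: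
  "T \<subseteq> S \<Longrightarrow> induced_subgraph (induced_subgraph G S) T = induced_subgraph G T"
  by (rule mgraph.equality) auto

lemma induced_subgraph_verts:
  assumes "multigraph G"
  shows "induced_subgraph G (verts G) = G"
proof -
  have "{e \<in> edges G. ends G e \<subseteq> verts G} = edges G"
    using multigraph_ends_subset[OF assms] by blast
  then show ?thesis
    by (simp add: induced_subgraph_def)
qed

lemma minor_of_induced_subgraph:
  assumes "multigraph G" "S \<subseteq> verts G"
  shows "minor_of G (induced_subgraph G S)"
proof -
  have "minor_of G (induced_subgraph G (verts G - D))" if "finite D" "D \<subseteq> verts G" for D
    using that
  proof (induction D rule: finite_induct)
    case empty
    then show ?case
      using minor_of.refl by (simp add: induced_subgraph_verts[OF assms(1)])
  next
    case (insert v D)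
    then have "minor_of G (delete_vertex (induced_subgraph G (verts G - D)) v)"
      by (intro minor_of.delete_vertex) auto
    moreover have "delete_vertex (induced_subgraph G (verts G - D)) v =
        induced_subgraph G (verts G - insert v D)"
      by (rule mgraph.equality) (auto simp: delete_vertex_def)
    ultimately show ?case
      by simp
  qed
  from this[of "verts G - S"] show ?thesis
    using assms by (simp add: multigraph_finite_verts double_diff)
qed

lemma component_induced_subgraph:
  assumes "component G x \<subseteq> S"
  shows "component (induced_subgraph G S) x = component G x"
proof
  have "adjacency (induced_subgraph G S) \<subseteq> adjacency G"
    by (auto simp: adjacency_def)
  then show "component (induced_subgraph G S) x \<subseteq> component G x"
    unfolding component_def by (intro Image_mono rtrancl_mono) auto
  have "(x, y) \<in> (adjacency (induced_subgraph G S))\<^sup>*" if "(x, y) \<in> (adjacency G)\<^sup>*" for y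
    using that
  proof (induction rule: rtrancl_induct)
    case (step y z)
    then obtain e where e: "e \<in> edges G" "y \<in> ends G e" "z \<in> ends G e"
      by (auto simp: adjacency_def)
    have "component G y = component G x"
      using step.hyps by (intro component_eq) (simp add: component_def)
    then have "ends G e \<subseteq> component G x"
      using ends_subset_component[OF e(1,2)] by simp
    then have "(y, z) \<in> adjacency (induced_subgraph G S)"
      using e assms by (auto simp: adjacency_def)
    with step.IH show ?case
      by (rule rtrancl_into_rtrancl)
  qed simp
  then show "component G x \<subseteq> component (induced_subgraph G S) x"
    by (auto simp: component_def)
qed

lemma components_induced_subgraph:
  assumes "J \<subseteq> components G"
  shows "components (induced_subgraph G (\<Union>J)) = J"
proof -
  have component: "component (induced_subgraph G (\<Union>J)) x = C" if "x \<in> C" "C \<in> J" for x C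
  proof -
    have "component G x = C"
      using that assms by (intro component_in_components) auto
    then show ?thesis
      using that component_induced_subgraph[of G x "\<Union>J"] by blast
  qed
  have "C \<in> components (induced_subgraph G (\<Union>J))" if C: "C \<in> J" for C
  proof -
    obtain x where "x \<in> C"
      using C assms components_nonempty[of C G] by auto
    then show ?thesis
      using C component by (auto simp: components_def)
  qed
  then show ?thesis
    using component by (auto simp: components_def)
qed

lemma card_edges_induced_subgraph_Union:
  assumes G: "multigraph G" and J: "J \<subseteq> components G"
  shows "card (edges (induced_subgraph G (\<Union>J))) =
    (\<Sum>C\<in>J. card (edges (induced_subgraph G C)))"
proof -
  have "\<exists>C\<in>J. ends G e \<subseteq> C" if e: "e \<in> edges G" "ends G e \<subseteq> \<Union>J" for e
  proof -
    obtain x C where x: "x \<in> ends G e" "x \<in> C" "C \<in> J"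
      using multigraph_ends_nonempty[OF G e(1)] e(2) by blast
    then have "component G x = C"
      using J by (intro component_in_components) auto
    then show ?thesis
      using ends_subset_component[OF e(1) x(1)] x(3) by blast
  qed
  then have "edges (induced_subgraph G (\<Union>J)) = (\<Union>C\<in>J. edges (induced_subgraph G C))"
    by auto
  also have "card \<dots> = (\<Sum>C\<in>J. card (edges (induced_subgraph G C)))"
  proof (rule card_UN_disjoint)
    show "finite J"
      using J finite_components[OF G] by (rule finite_subset)
    show "\<forall>C\<in>J. finite (edges (induced_subgraph G C))"
      using multigraph_finite_edges[OF G] by simp
    have "C \<inter> D = {}" if "C \<in> J" "D \<in> J" "C \<noteq> D" for C D
      using that pairwise_subset[OF pairwise_disjnt_components J]
      by (simp add: pairwise_def disjnt_def)
    then show "\<forall>C\<in>J. \<forall>D\<in>J. C \<noteq> D \<longrightarrow>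
        edges (induced_subgraph G C) \<inter> edges (induced_subgraph G D) = {}"
      using multigraph_ends_nonempty[OF G] by fastforce
  qed
  finally show ?thesis .
qed

lemma cyclomatic_number_induced_subgraph_Union:
  assumes G: "multigraph G" and J: "J \<subseteq> components G"
  shows "cyclomatic_number (induced_subgraph G (\<Union>J)) =
    (\<Sum>C\<in>J. cyclomatic_number (induced_subgraph G C))"
proof -
  have multigraph: "multigraph (induced_subgraph G S)" if "S \<subseteq> verts G" for S
    using minor_of_induced_subgraph[OF G that] G by (rule multigraph_minor_of)
  have "card (edges (induced_subgraph G C)) + 1 = card C + cyclomatic_number (induced_subgraph G C)"
    if "C \<in> J" for C
  proof -
    have "components (induced_subgraph G C) = {C}"
      using components_induced_subgraph[of "{C}" G] that J by auto
    moreover have "C \<subseteq> verts G"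
      using that J Union_components[OF G] by blast
    ultimately show ?thesis
      using cyclomatic_number_eq[OF multigraph, of C] by simp
  qed
  then have "(\<Sum>C\<in>J. card (edges (induced_subgraph G C)) + 1) =
      (\<Sum>C\<in>J. card C + cyclomatic_number (induced_subgraph G C))"
    by (rule sum.cong[OF HOL.refl])
  then have "card (edges (induced_subgraph G (\<Union>J))) + card J =
      card (\<Union>J) + (\<Sum>C\<in>J. cyclomatic_number (induced_subgraph G C))"
    unfolding card_edges_induced_subgraph_Union[OF G J] card_Union_subset_components[OF G J]
    by (simp only: sum.distrib sum_constant) simp
  then show ?thesis
    by (simp add: cyclomatic_number_def components_induced_subgraph[OF J])
qed

corollary cyclomatic_number_eq_sum_components:
  assumes "multigraph G"
  shows "cyclomatic_number G = (\<Sum>C\<in>components G. cyclomatic_number (induced_subgraph G C))"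
  using cyclomatic_number_induced_subgraph_Union[OF assms order_refl] assms
  by (simp add: Union_components induced_subgraph_verts)

section \<open>Extremal functions and limiting densities\<close>

lemma card_edges_le_ex: "G \<in> F \<Longrightarrow> enat (card (edges G)) \<le> ex F (card (verts G))"
  unfolding ex_def by (intro SUP_upper) simp

lemma limiting_density_le:
  assumes bound: "\<And>G. G \<in> F \<Longrightarrow> N \<le> card (verts G) \<Longrightarrow>
      real (card (edges G)) \<le> a * real (card (verts G)) + c"
    and "0 \<le> a" "0 \<le> c"
  shows "limiting_density F \<le> ereal a"
proof -
  have "ereal_of_enat (ex F n) / ereal (real n) \<le> ereal (a + c / real n)" if n: "n \<ge> max N 1" for n
  proof -
    have "ex F n \<le> enat (nat \<lfloor>a * real n + c\<rfloor>)"
      unfolding ex_def using bound n by (intro SUP_least) (auto simp: le_nat_floor)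
    then have "ereal_of_enat (ex F n) \<le> ereal (real (nat \<lfloor>a * real n + c\<rfloor>))"
      by (metis ereal_of_enat_le_iff ereal_of_enat_simps(1))
    also have "\<dots> \<le> ereal (a * real n + c)"
      using \<open>0 \<le> a\<close> \<open>0 \<le> c\<close> by simp
    finally have "ereal_of_enat (ex F n) / ereal (real n) \<le> ereal (a * real n + c) / ereal (real n)"
      using n by (intro ereal_divide_right_mono) auto
    also have "\<dots> = ereal (a + c / real n)"
      using n by (simp add: field_simps)
    finally show ?thesis .
  qed
  then have "limiting_density F \<le> limsup (\<lambda>n. ereal (a + c / real n))"
    unfolding limiting_density_def by (intro Limsup_mono eventually_sequentiallyI)
  also have "\<dots> = ereal a"
  proof (rule lim_imp_Limsup)
    have "(\<lambda>n. a + c / real n) \<longlonglongrightarrow> a + 0"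
      by (intro tendsto_add tendsto_const lim_const_over_n)
    then show "(\<lambda>n. ereal (a + c / real n)) \<longlonglongrightarrow> ereal a"
      by simp
  qed simp
  finally show ?thesis .
qed

lemma limiting_density_ge:
  fixes r m :: "nat \<Rightarrow> nat"
  assumes "strict_mono r"
    and ex: "\<And>q. enat (m q) \<le> ex F (r q)"
    and m: "\<And>q. a * real (r q) \<le> real (m q) + c"
  shows "ereal a \<le> limiting_density F"
proof -
  have r: "filterlim r at_top sequentially"
    using \<open>strict_mono r\<close> by (rule filterlim_subseq)
  have "(\<lambda>q. a - c / real (r q)) \<longlonglongrightarrow> a - 0"
    by (intro tendsto_diff tendsto_const filterlim_compose[OF lim_const_over_n r])
  then have "ereal a = limsup (\<lambda>q. ereal (a - c / real (r q)))"
    by (intro lim_imp_Limsup[symmetric]) auto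
  also have "\<dots> \<le> limsup ((\<lambda>n. ereal_of_enat (ex F n) / ereal (real n)) \<circ> r)"
  proof (rule Limsup_mono)
    have "\<forall>\<^sub>F q in sequentially. 1 \<le> r q"
      using r by (simp add: filterlim_at_top)
    then show "\<forall>\<^sub>F q in sequentially. ereal (a - c / real (r q)) \<le>
        ((\<lambda>n. ereal_of_enat (ex F n) / ereal (real n)) \<circ> r) q"
    proof eventually_elim
      case (elim q)
      have "a - c / real (r q) = (a * real (r q) - c) / real (r q)"
        using elim by (simp add: field_simps)
      also have "\<dots> \<le> real (m q) / real (r q)"
        using m[of q] by (intro divide_right_mono) simp_all
      finally have "ereal (a - c / real (r q)) \<le> ereal (real (m q)) / ereal (real (r q))"
        using elim by simp
      also have "\<dots> \<le> ereal_of_enat (ex F (r q)) / ereal (real (r q))"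
        using ex[of q] elim
        by (intro ereal_divide_right_mono) (metis ereal_of_enat_le_iff ereal_of_enat_simps(1), simp)
      finally show ?case
        by simp
    qed
  qed
  also have "\<dots> \<le> limiting_density F"
    unfolding limiting_density_def using \<open>strict_mono r\<close> by (rule limsup_subseq_mono)
  finally show ?thesis .
qed

lemma finite_limiting_density_imp_finite_ex:
  assumes "limiting_density F \<noteq> \<infinity>"
  obtains N E where "1 \<le> N" "ex F N = enat E"
proof -
  obtain b where "limiting_density F < ereal b"
    using assms less_PInf_Ex_of_nat by (metis ereal_infty_less(1))
  then have "\<forall>\<^sub>F n in sequentially. ereal_of_enat (ex F n) / ereal (real n) < ereal b"
    unfolding limiting_density_def by (rule Limsup_lessD)
  then obtain N where "1 \<le> N" "ereal_of_enat (ex F N) / ereal (real N) < ereal b"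
    unfolding eventually_sequentially by (metis nat_le_linear)
  then show ?thesis
    by (cases "ex F N") (auto intro: that)
qed

section \<open>Abundant components\<close>

definition abundant_components ::
  "('v, 'e) mgraph set \<Rightarrow> (('v, 'e) mgraph \<Rightarrow> nat) \<Rightarrow> nat \<Rightarrow> bool" where
  "abundant_components F f k \<longleftrightarrow>
     (\<forall>q. \<exists>G \<in> F. q \<le> card {C \<in> components G. k \<le> f (induced_subgraph G C)})"

lemma sum_components_le_if_not_abundant:
  assumes "\<not> abundant_components F f (Suc k)" and multigraph: "\<And>G. G \<in> F \<Longrightarrow> multigraph G"
  obtains p where "\<And>G R. G \<in> F \<Longrightarrow> (\<And>C. C \<in> components G \<Longrightarrow> f (induced_subgraph G C) \<le> R) \<Longrightarrow>
    (\<Sum>C\<in>components G. f (induced_subgraph G C)) \<le> k * card (components G) + p * R"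
proof -
  obtain p where p: "card {C \<in> components G. k < f (induced_subgraph G C)} < p" if "G \<in> F" for G
    using assms(1) by (auto simp: abundant_components_def not_le Suc_le_eq)
  have "(\<Sum>C\<in>components G. f (induced_subgraph G C)) \<le> k * card (components G) + p * R"
    if G: "G \<in> F" and R: "\<And>C. C \<in> components G \<Longrightarrow> f (induced_subgraph G C) \<le> R" for G R
  proof -
    let ?f = "\<lambda>C. f (induced_subgraph G C)"
    have "(\<Sum>C\<in>components G. ?f C) \<le> (\<Sum>C\<in>components G. k + (if k < ?f C then R else 0))"
      using R by (intro sum_mono) (auto intro: trans_le_add2)
    also have "\<dots> = k * card (components G) + card {C \<in> components G. k < ?f C} * R"
      using finite_components[OF multigraph[OF G]] by (simp add: sum.distrib sum.If_cases Int_def)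
    also have "\<dots> \<le> k * card (components G) + p * R"
      using p[OF G] by simp
    finally show ?thesis .
  qed
  then show ?thesis
    by (rule that)
qed

locale minor_closed_family =
  fixes F :: "('v, 'e) mgraph set"
  assumes multigraph: "G \<in> F \<Longrightarrow> multigraph G"
    and minor_closed: "minor_closed F"
begin

lemma minor_in: "G \<in> F \<Longrightarrow> minor_of G H \<Longrightarrow> H \<in> F"
  using minor_closed by (simp add: minor_closed_def)

lemma induced_subgraph_in: "G \<in> F \<Longrightarrow> S \<subseteq> verts G \<Longrightarrow> induced_subgraph G S \<in> F"
  using minor_in[OF _ minor_of_induced_subgraph[OF multigraph]] .

lemma induced_subgraph_Union_components_in:
  assumes "G \<in> F" "J \<subseteq> components G"
  shows "induced_subgraph G (\<Union>J) \<in> F"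
  using assms(2) Union_components[OF multigraph[OF assms(1)]]
  by (intro induced_subgraph_in assms(1)) auto

lemma contraction_le_ex:
  assumes G: "G \<in> F" and n: "card (components G) \<le> n" "n \<le> card (verts G)"
  shows "enat (n - card (components G) + cyclomatic_number G) \<le> ex F n"
proof -
  obtain H where H: "minor_of G H" "card (verts H) = n" "card (components H) = card (components G)"
    "cyclomatic_number H = cyclomatic_number G"
    using exists_contraction_with_card_verts[OF multigraph[OF G] n] by blast
  have "H \<in> F"
    using G H(1) by (rule minor_in)
  moreover have "card (edges H) = n - card (components G) + cyclomatic_number G"
    using cyclomatic_number_eq[OF multigraph[OF \<open>H \<in> F\<close>]] H n(1) by simp
  ultimately show ?thesis
    using card_edges_le_ex[of H F] H(2) by simp
qed

lemma cyclomatic_number_le_ex: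
  assumes "G \<in> F"
  shows "enat (cyclomatic_number G) \<le> ex F (card (components G))"
  using contraction_le_ex[OF assms order_refl card_components_le[OF multigraph[OF assms]]] by simp

lemma abundant_componentsE:
  assumes "abundant_components F f k"
  obtains H where "H \<in> F" "card (components H) = q"
    "\<And>C. C \<in> components H \<Longrightarrow> k \<le> f (induced_subgraph H C)"
proof -
  obtain G where G: "G \<in> F" "q \<le> card {C \<in> components G. k \<le> f (induced_subgraph G C)}"
    using assms by (auto simp: abundant_components_def)
  then obtain J where J: "J \<subseteq> {C \<in> components G. k \<le> f (induced_subgraph G C)}" "card J = q"
    by (meson obtain_subset_with_card_n)
  let ?H = "induced_subgraph G (\<Union>J)"
  have "J \<subseteq> components G"
    using J(1) by blast
  then have H: "?H \<in> F" "components ?H = J"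
    using G(1) by (simp_all add: induced_subgraph_Union_components_in components_induced_subgraph)
  have "k \<le> f (induced_subgraph ?H C)" if "C \<in> J" for C
  proof -
    have "induced_subgraph ?H C = induced_subgraph G C"
      using that by (intro induced_subgraph_induced_subgraph Union_upper)
    then show ?thesis
      using that J(1) by auto
  qed
  then show ?thesis
    using H J(2) by (intro that[of ?H]) simp_all
qed

lemma abundant_cyclomatic_number_le_ex:
  assumes "abundant_components F cyclomatic_number k"
  shows "enat (k * q) \<le> ex F q"
proof -
  obtain H where H: "H \<in> F" "card (components H) = q"
    "\<And>C. C \<in> components H \<Longrightarrow> k \<le> cyclomatic_number (induced_subgraph H C)"
    using abundant_componentsE[OF assms] by blast
  have "k * q \<le> cyclomatic_number H"
    unfolding cyclomatic_number_eq_sum_components[OF multigraph[OF H(1)]]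
    using sum_bounded_below[of "components H" k] H(2,3) by (simp add: mult.commute)
  then show ?thesis
    using cyclomatic_number_le_ex[OF H(1)] H(2) by (metis enat_ord_simps(1) order_trans)
qed

lemma abundant_card_verts_le_ex:
  assumes "abundant_components F (\<lambda>H. card (verts H)) (Suc s)"
  shows "enat (s * q) \<le> ex F (Suc s * q)"
proof -
  obtain H where H: "H \<in> F" "card (components H) = q" "\<And>C. C \<in> components H \<Longrightarrow> Suc s \<le> card C"
    using abundant_componentsE[OF assms] by auto
  have "Suc s * q \<le> card (verts H)"
    unfolding card_verts_eq_sum_components[OF multigraph[OF H(1)]]
    using sum_bounded_below[of "components H" "Suc s" card] H(2,3) by (simp add: mult.commute)
  then have "enat (Suc s * q - q + cyclomatic_number H) \<le> ex F (Suc s * q)"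
    using contraction_le_ex[OF H(1), of "Suc s * q"] H(2) by simp
  then show ?thesis
    by (rule order_trans[rotated]) simp
qed

lemma card_component_le_ex:
  assumes "G \<in> F" "C \<in> components G" "Suc n \<le> card C"
  shows "enat n \<le> ex F (Suc n)"
proof -
  have "induced_subgraph G C \<in> F" "components (induced_subgraph G C) = {C}"
    using assms(1,2) induced_subgraph_Union_components_in[of G "{C}"]
      components_induced_subgraph[of "{C}" G] by auto
  then have "enat (n + cyclomatic_number (induced_subgraph G C)) \<le> ex F (Suc n)"
    using contraction_le_ex[of "induced_subgraph G C" "Suc n"] assms(3) by simp
  then show ?thesis
    by (rule order_trans[rotated]) simp
qed

lemma component_cyclomatic_number_le_ex:
  assumes G: "G \<in> F" "C \<in> components G" and N: "1 \<le> N" "N \<le> card (components G)"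
  shows "enat (cyclomatic_number (induced_subgraph G C)) \<le> ex F N"
proof -
  obtain J where J: "{C} \<subseteq> J" "J \<subseteq> components G" "card J = N"
    using exists_subset_between[of "{C}" N "components G"] G N finite_components multigraph by auto
  have "finite J"
    using J(2) finite_components[OF multigraph[OF G(1)]] by (rule finite_subset)
  then have "cyclomatic_number (induced_subgraph G C) \<le>
      (\<Sum>D\<in>J. cyclomatic_number (induced_subgraph G D))"
    using J(1) by (intro member_le_sum) auto
  also have "\<dots> = cyclomatic_number (induced_subgraph G (\<Union>J))"
    using cyclomatic_number_induced_subgraph_Union[OF multigraph[OF G(1)] J(2)] by simp
  finally have "enat (cyclomatic_number (induced_subgraph G C)) \<le>
      enat (cyclomatic_number (induced_subgraph G (\<Union>J)))"
    by simp
  also have "\<dots> \<le> ex F N"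
    using cyclomatic_number_le_ex[OF induced_subgraph_Union_components_in[OF G(1) J(2)]]
    by (simp add: components_induced_subgraph[OF J(2)] J(3))
  finally show ?thesis .
qed

lemma cyclomatic_number_bound:
  assumes finite: "limiting_density F \<noteq> \<infinity>"
    and few: "\<not> abundant_components F cyclomatic_number (Suc k)"
  obtains N B where "\<And>G. G \<in> F \<Longrightarrow> N \<le> card (verts G) \<Longrightarrow>
    cyclomatic_number G \<le> k * card (components G) + B"
proof -
  obtain N E where N: "1 \<le> N" "ex F N = enat E"
    using finite_limiting_density_imp_finite_ex[OF finite] .
  obtain p where p: "\<And>G R. G \<in> F \<Longrightarrow>
    (\<And>C. C \<in> components G \<Longrightarrow> cyclomatic_number (induced_subgraph G C) \<le> R) \<Longrightarrow>
    (\<Sum>C\<in>components G. cyclomatic_number (induced_subgraph G C)) \<le>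
      k * card (components G) + p * R"
    using sum_components_le_if_not_abundant[OF few multigraph] by blast
  have "cyclomatic_number G \<le> k * card (components G) + (p + 1) * E"
    if G: "G \<in> F" and large: "N \<le> card (verts G)" for G
  proof (cases "card (components G) \<le> N")
    case True
    then have "cyclomatic_number G \<le> E"
      using contraction_le_ex[OF G True large] N(2) by simp
    then show ?thesis
      by (simp add: trans_le_add2)
  next
    case False
    then have "cyclomatic_number (induced_subgraph G C) \<le> E" if "C \<in> components G" for C
      using component_cyclomatic_number_le_ex[OF G that N(1)] N(2) by simp
    then have "cyclomatic_number G \<le> k * card (components G) + p * E"
      unfolding cyclomatic_number_eq_sum_components[OF multigraph[OF G]] by (rule p[OF G])
    then show ?thesis
      by simp
  qed
  then show ?thesis
    by (rule that)
qed

section \<open>The three kinds of densities\<close>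

lemma limiting_density_eq_greatest_abundant:
  assumes finite: "limiting_density F \<noteq> \<infinity>" and "1 \<le> k"
    and many: "abundant_components F cyclomatic_number k"
    and few: "\<not> abundant_components F cyclomatic_number (Suc k)"
  shows "limiting_density F = ereal (real k)"
proof (rule antisym)
  obtain N B where B: "\<And>G. G \<in> F \<Longrightarrow> N \<le> card (verts G) \<Longrightarrow>
      cyclomatic_number G \<le> k * card (components G) + B"
    using cyclomatic_number_bound[OF finite few] by blast
  show "limiting_density F \<le> ereal (real k)"
  proof (rule limiting_density_le[where N = N and c = "real B"])
    fix G assume G: "G \<in> F" "N \<le> card (verts G)"
    obtain j where k: "k = Suc j"
      using \<open>1 \<le> k\<close> by (cases k) auto
    have "j * card (components G) \<le> j * card (verts G)"
      by (intro mult_le_mono2 card_components_le multigraph G)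
    then have "card (edges G) \<le> k * card (verts G) + B"
      using B[OF G] cyclomatic_number_eq[OF multigraph[OF G(1)]] unfolding k mult_Suc by linarith
    then show "real (card (edges G)) \<le> real k * real (card (verts G)) + real B"
      by (metis of_nat_add of_nat_le_iff of_nat_mult)
  qed simp_all
  show "ereal (real k) \<le> limiting_density F"
    by (rule limiting_density_ge[OF strict_mono_id, where m = "\<lambda>q. k * q" and c = 0])
      (simp_all add: abundant_cyclomatic_number_le_ex[OF many])
qed

lemma limiting_density_eq_nat_if_abundant:
  assumes finite: "limiting_density F \<noteq> \<infinity>" and "abundant_components F cyclomatic_number 1"
  shows "\<exists>k::nat. limiting_density F = ereal (real k)"
proof -
  obtain N E where N: "1 \<le> N" "ex F N = enat E"
    using finite_limiting_density_imp_finite_ex[OF finite] .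
  have "k \<le> E" if "abundant_components F cyclomatic_number k" for k
  proof -
    have "k \<le> k * N"
      using N(1) by simp
    also have "\<dots> \<le> E"
      using abundant_cyclomatic_number_le_ex[OF that, of N] N(2) by simp
    finally show ?thesis .
  qed
  then obtain k where k: "abundant_components F cyclomatic_number k"
    and maximal: "\<And>j. abundant_components F cyclomatic_number j \<Longrightarrow> j \<le> k"
    using assms(2) Nat.ex_has_greatest_nat[of "abundant_components F cyclomatic_number" 1 E]
    by blast
  have "\<not> abundant_components F cyclomatic_number (Suc k)"
    using maximal[of "Suc k"] by auto
  then show ?thesis
    using limiting_density_eq_greatest_abundant[OF finite maximal[OF assms(2)] k] by blast
qed

lemma limiting_density_eq_1_if_unbounded_components:
  assumes finite: "limiting_density F \<noteq> \<infinity>"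
    and few: "\<not> abundant_components F cyclomatic_number 1"
    and unbounded: "\<And>r. \<exists>G\<in>F. \<exists>C\<in>components G. r \<le> card C"
  shows "limiting_density F = 1"
proof -
  obtain N B where B: "\<And>G. G \<in> F \<Longrightarrow> N \<le> card (verts G) \<Longrightarrow> cyclomatic_number G \<le> B"
    using cyclomatic_number_bound[OF finite, of 0] few by auto
  have "limiting_density F \<le> ereal 1"
  proof (rule limiting_density_le[where N = N and c = "real B"])
    fix G assume G: "G \<in> F" "N \<le> card (verts G)"
    show "real (card (edges G)) \<le> 1 * real (card (verts G)) + real B"
      using B[OF G] cyclomatic_number_eq[OF multigraph[OF G(1)]] by simp
  qed simp_all
  moreover have "enat q \<le> ex F (Suc q)" for q
    using unbounded[of "Suc q"] card_component_le_ex by blast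
  then have "ereal 1 \<le> limiting_density F"
    by (intro limiting_density_ge[where r = Suc and m = "\<lambda>q. q" and c = 1])
      (simp_all add: strict_mono_Suc_iff)
  ultimately show ?thesis
    by (simp add: one_ereal_def antisym)
qed

lemma limiting_density_le_superparticular:
  assumes finite: "limiting_density F \<noteq> \<infinity>"
    and few: "\<not> abundant_components F cyclomatic_number 1"
    and bounded: "\<And>G C. G \<in> F \<Longrightarrow> C \<in> components G \<Longrightarrow> card C \<le> R"
    and small: "\<not> abundant_components F (\<lambda>H. card (verts H)) (Suc (Suc s))"
  shows "limiting_density F \<le> ereal (real s / real (Suc s))"
proof -
  obtain N B where B: "\<And>G. G \<in> F \<Longrightarrow> N \<le> card (verts G) \<Longrightarrow> cyclomatic_number G \<le> B"
    using cyclomatic_number_bound[OF finite, of 0] few by auto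
  obtain p where p: "\<And>G R. G \<in> F \<Longrightarrow>
    (\<And>C. C \<in> components G \<Longrightarrow> card (verts (induced_subgraph G C)) \<le> R) \<Longrightarrow>
    (\<Sum>C\<in>components G. card (verts (induced_subgraph G C))) \<le> Suc s * card (components G) + p * R"
    using sum_components_le_if_not_abundant[OF small multigraph] by blast
  show ?thesis
  proof (rule limiting_density_le[where N = N and c = "real (p * R + B)"])
    fix G assume G: "G \<in> F" "N \<le> card (verts G)"
    have "card (edges G) + card (components G) \<le> card (verts G) + B"
      using B[OF G] cyclomatic_number_eq[OF multigraph[OF G(1)]] by simp
    then have "Suc s * (card (edges G) + card (components G)) \<le> Suc s * (card (verts G) + B)"
      by (rule mult_le_mono2)
    moreover have "card (verts G) \<le> Suc s * card (components G) + p * R"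
      using p[OF G(1)] bounded[OF G(1)]
      by (simp only: card_verts_eq_sum_components[OF multigraph[OF G(1)]] induced_subgraph_simps)
    ultimately have "Suc s * card (edges G) \<le> s * card (verts G) + Suc s * (p * R + B)"
      by (simp add: algebra_simps)
    then have "real (Suc s) * real (card (edges G)) \<le>
        real s * real (card (verts G)) + real (Suc s) * real (p * R + B)"
      by (metis of_nat_add of_nat_le_iff of_nat_mult)
    then show "real (card (edges G)) \<le>
        real s / real (Suc s) * real (card (verts G)) + real (p * R + B)"
      by (simp add: field_simps)
  qed simp_all
qed

lemma limiting_density_superparticular_if_bounded_components:
  assumes finite: "limiting_density F \<noteq> \<infinity>"
    and few: "\<not> abundant_components F cyclomatic_number 1"
    and bounded: "\<And>G C. G \<in> F \<Longrightarrow> C \<in> components G \<Longrightarrow> card C \<le> R"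
  shows "\<exists>s::nat. limiting_density F = ereal (real s / real (s + 1))"
proof -
  let ?P = "\<lambda>s. s = 0 \<or> abundant_components F (\<lambda>H. card (verts H)) (Suc s)"
  have "s \<le> R" if "?P s" for s
    using that
  proof
    assume "abundant_components F (\<lambda>H. card (verts H)) (Suc s)"
    then obtain H where H: "H \<in> F" "card (components H) = 1"
      "\<And>C. C \<in> components H \<Longrightarrow> Suc s \<le> card C"
      using abundant_componentsE[of "\<lambda>H. card (verts H)" "Suc s" 1] by auto
    then obtain C where "C \<in> components H"
      by fastforce
    then show ?thesis
      using H(3) bounded[OF H(1)] by fastforce
  qed simp
  then obtain s where s: "?P s" and maximal: "\<And>t. ?P t \<Longrightarrow> t \<le> s"
    using Nat.ex_has_greatest_nat[of ?P 0 R] by blast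
  have "enat (s * q) \<le> ex F (Suc s * q)" for q
    using s abundant_card_verts_le_ex[of s q] by (auto simp: zero_enat_def[symmetric])
  then have "ereal (real s / real (Suc s)) \<le> limiting_density F"
    by (intro limiting_density_ge[where r = "\<lambda>q. Suc s * q" and m = "\<lambda>q. s * q" and c = 0])
      (simp_all add: strict_mono_def del: of_nat_Suc mult_Suc)
  moreover have "\<not> abundant_components F (\<lambda>H. card (verts H)) (Suc (Suc s))"
    using maximal[of "Suc s"] by auto
  with finite few bounded have "limiting_density F \<le> ereal (real s / real (Suc s))"
    by (rule limiting_density_le_superparticular)
  ultimately show ?thesis
    by (intro exI[of _ s]) (simp add: antisym)
qed

theorem limiting_density_cases:
  obtains (infinite) "limiting_density F = \<infinity>"
    | (nat) k :: nat where "limiting_density F = ereal (real k)"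
    | (ratio) s :: nat where "limiting_density F = ereal (real s / real (s + 1))"
proof -
  consider "limiting_density F = \<infinity>"
    | (abundant) "limiting_density F \<noteq> \<infinity>" "abundant_components F cyclomatic_number 1"
    | (not_abundant) "limiting_density F \<noteq> \<infinity>" "\<not> abundant_components F cyclomatic_number 1"
    by blast
  then show ?thesis
  proof cases
    case abundant
    then show ?thesis
      using limiting_density_eq_nat_if_abundant nat by blast
  next
    case not_abundant
    show ?thesis
    proof (cases "\<forall>r. \<exists>G\<in>F. \<exists>C\<in>components G. r \<le> card C")
      case True
      then have "limiting_density F = 1"
        using limiting_density_eq_1_if_unbounded_components[OF not_abundant] by blast
      then show ?thesis
        using nat[of 1] by (simp add: one_ereal_def)
    next
      case False
      then obtain R where "\<And>G C. G \<in> F \<Longrightarrow> C \<in> components G \<Longrightarrow> card C \<le> R"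
        using nat_le_linear by blast
      then show ?thesis
        using limiting_density_superparticular_if_bounded_components[OF not_abundant] ratio by blast
    qed
  qed (rule infinite)
qed

end

theorem theorem5:
  fixes F :: "(nat, nat) mgraph set"
  assumes "\<forall>G \<in> F. multigraph G"
    and "minor_closed F"
  shows "(\<exists>k::int. limiting_density F = ereal (real_of_int k)) \<or>
    (\<exists>i::nat. i \<ge> 1 \<and> limiting_density F = ereal (real i / real (i + 1))) \<or>
    limiting_density F = \<infinity>"
proof -
  interpret minor_closed_family F
    using assms by unfold_locales auto
  show ?thesis
  proof (cases rule: limiting_density_cases)
    case (nat k)
    then have "limiting_density F = ereal (real_of_int (int k))"
      by simp
    then show ?thesis
      by blast
  next
    case (ratio s)
    show ?thesis
    proof (cases "s = 0")
      case True
      then have "limiting_density F = ereal (real_of_int 0)"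
        using ratio by simp
      then show ?thesis
        by blast
    next
      case False
      then show ?thesis
        using ratio by (metis less_one not_le)
    qed
  qed simp
qed

end
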